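(* Let $0\le\sigma_1,\sigma_2<1$ with $(\sigma_1,\sigma_2)\ne(0,0)$, and let $g(z)=1+\sigma_1z_1^2+\sigma_2z_2^2$ on $\mathbb C^2$. The following are equivalent. (1) There is a polynomial map $P$ (from $\mathbb C^2$ to some $\mathbb C^N$), with $P(0)=0$ and $\deg P=3$, such that $P/g$ is a reduced sphere map. (2) There is a positive diagonal $2\times2$ matrix $X$ such that $M_X\ge0$ and $M_X\ne0$.
   Context: Sphere maps: $\mathbb B^2$ is the open unit ball of $\mathbb C^2$. A sphere map is a rational map $P/g$, holomorphic on $\mathbb B^2$, with $P=(p_1,\dots,p_N)^t$ a polynomial map, $g$ a scalar polynomial and $\|P(z)\|^2=|g(z)|^2$ for $z\in\partial\mathbb B^2$. It is reduced if $g,p_1,\dots,p_N$ have no common nonconstant polynomial factor. Matrices: put \[ T=\begin{pmatrix}\sigma_1&0&\sigma_2/\sqrt3&0\\0&\sigma_1/\sqrt3&0&\sigma_2\end{pmatrix}, \] and for a diagonal matrix $X=\operatorname{diag}(x,y)$ with $x,y>0$ put \[ S_X=\operatorname{diag}\Bigl(x,\tfrac{2x+y}{3},\tfrac{x+2y}{3},y\Bigr),\qquad M_X=I_4+T^*T-S_X-T^*X^{-1}T . \] (With $V_1=(z_1,z_2)^t$, $V_3=(z_1^3,\sqrt3z_1^2z_2,\sqrt3z_1z_2^2,z_2^3)^t$ and $q=g-1$, one has $qV_1=TV_3$ and $V_3^*S_XV_3=\|z\|^4V_1^*XV_1$.) $^*$ is the conjugate transpose; $H\ge0$ means $H$ is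 Hermitian positive semidefinite. *)

theory Defs
  imports "HOL-Analysis.Analysis" "HOL-Computational_Algebra.Polynomial"
begin

section \<open>Polynomials in two complex variables\<close>

text \<open>
  The ring of polynomials in $z_1, z_2$ over the complex numbers is represented by
  \<^typ>\<open>complex poly poly\<close>: the outer variable is $z_1$, the inner one $z_2$, so that
  the coefficient of $z_1^i z_2^j$ in \<open>p\<close> is \<open>coeff (coeff p i) j\<close>.
  Points are elements of \<^typ>\<open>complex^2\<close>, whose \<^const>\<open>norm\<close> is the Euclidean norm.
\<close>

definition eval2 :: "complex poly poly \<Rightarrow> complex^2 \<Rightarrow> complex" where
  "eval2 p z = poly (poly p [:z$1:]) (z$2)"

definition Z1 :: "complex poly poly" where "Z1 = [:0, 1:]"

definition Z2 :: "complex poly poly" where "Z2 = [:[:0, 1:]:]"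

definition Const :: "complex \<Rightarrow> complex poly poly" where "Const c = [:[:c:]:]"

lemma eval2_simps [simp]:
  "eval2 0 z = 0" "eval2 1 z = 1"
  "eval2 (p + q) z = eval2 p z + eval2 q z"
  "eval2 (p - q) z = eval2 p z - eval2 q z"
  "eval2 (- p) z = - eval2 p z"
  "eval2 (p * q) z = eval2 p z * eval2 q z"
  "eval2 (p ^ n) z = eval2 p z ^ n"
  "eval2 Z1 z = z$1" "eval2 Z2 z = z$2" "eval2 (Const c) z = c"
  by (simp_all add: eval2_def Z1_def Z2_def Const_def)

text \<open>The zero polynomial gets total degree \<open>0\<close>.\<close>

definition total_degree :: "complex poly poly \<Rightarrow> nat" where
  "total_degree p = Max (insert 0 {i + j | i j. coeff (coeff p i) j \<noteq> 0})"

lemma finite_total_degree_set: "finite {i + j | i j. coeff (coeff p i) j \<noteq> (0::complex)}"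
proof -
  let ?A = "SIGMA i : {..degree p}. {..degree (coeff p i)}"
  have "i \<le> degree p \<and> j \<le> degree (coeff p i)" if "coeff (coeff p i) j \<noteq> 0" for i j
    using that by (metis coeff_0 le_degree)
  then have "{i + j | i j. coeff (coeff p i) j \<noteq> 0} \<subseteq> (\<lambda>(i, j). i + j) ` ?A"
    by force
  then show ?thesis
    by (rule finite_subset) auto
qed

text \<open>
  A polynomial map into $\mathbf{C}^N$ is the list of its \<open>N\<close> components; its degree is the
  largest total degree of a component.
\<close>

definition map_degree :: "complex poly poly list \<Rightarrow> nat" where
  "map_degree P = Max (insert 0 (total_degree ` set P))"


section \<open>Sphere maps\<close>

text \<open>
  Holomorphy in two variables is complex differentiability: the real Frechet derivative exists
  and is complex linear. This is the usual notion on open sets, the only ones it is used for.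
\<close>

definition holomorphic2_on :: "(complex^2 \<Rightarrow> complex) \<Rightarrow> (complex^2) set \<Rightarrow> bool" where
  "holomorphic2_on f U \<longleftrightarrow>
     (\<forall>z\<in>U. \<exists>a b. (f has_derivative (\<lambda>h. a * h$1 + b * h$2)) (at z))"

text \<open>
  A rational function \<open>p/g\<close> is holomorphic on the open set \<open>U\<close> if it has a holomorphic
  representative there. The product form avoids the convention \<open>x / 0 = 0\<close>: the zero set of
  \<open>g \<noteq> 0\<close> has empty interior, so \<open>f\<close> is the unique extension of the pointwise quotient.
\<close>

definition rational_holomorphic_on ::
    "complex poly poly \<Rightarrow> complex poly poly \<Rightarrow> (complex^2) set \<Rightarrow> bool" where
  "rational_holomorphic_on p g U \<longleftrightarrow>
     g \<noteq> 0 \<and> (\<exists>f. holomorphic2_on f U \<and> (\<forall>z\<in>U. f z * eval2 g z = eval2 p z))"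

definition sphere_map :: "complex poly poly list \<Rightarrow> complex poly poly \<Rightarrow> bool" where
  "sphere_map P g \<longleftrightarrow>
     (\<forall>p\<in>set P. rational_holomorphic_on p g (ball 0 1)) \<and>
     (\<forall>z\<in>sphere 0 1. (\<Sum>p\<leftarrow>P. (cmod (eval2 p z))\<^sup>2) = (cmod (eval2 g z))\<^sup>2)"

definition reduced_quotient :: "complex poly poly list \<Rightarrow> complex poly poly \<Rightarrow> bool" where
  "reduced_quotient P g \<longleftrightarrow> \<not> (\<exists>h. total_degree h > 0 \<and> h dvd g \<and> (\<forall>p\<in>set P. h dvd p))"

definition g_poly :: "real \<Rightarrow> real \<Rightarrow> complex poly poly" where
  "g_poly \<sigma>1 \<sigma>2 = 1 + Const (of_real \<sigma>1) * Z1\<^sup>2 + Const (of_real \<sigma>2) * Z2\<^sup>2"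

lemma eval2_g_poly:
  "eval2 (g_poly \<sigma>1 \<sigma>2) z = 1 + of_real \<sigma>1 * (z$1)\<^sup>2 + of_real \<sigma>2 * (z$2)\<^sup>2"
  by (simp add: g_poly_def)


section \<open>Matrices\<close>

definition conj_transpose :: "complex^'n^'m \<Rightarrow> complex^'m^'n" where
  "conj_transpose A = (\<chi> i j. cnj (A$j$i))"

definition diag_matrix :: "complex^'n \<Rightarrow> complex^'n^'n" where
  "diag_matrix v = (\<chi> i j. if i = j then v$i else 0)"

text \<open>For Hermitian \<open>A\<close> the quadratic form is real valued.\<close>

definition pos_semidef :: "complex^'n^'n \<Rightarrow> bool" where
  "pos_semidef A \<longleftrightarrow> conj_transpose A = A \<and>
     (\<forall>v. 0 \<le> Re (\<Sum>i\<in>UNIV. cnj (v$i) * (A *v v)$i))"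

definition T_matrix :: "real \<Rightarrow> real \<Rightarrow> complex^4^2" where
  "T_matrix \<sigma>1 \<sigma>2 = vector
     [vector [of_real \<sigma>1, 0, of_real (\<sigma>2 / sqrt 3), 0],
      vector [0, of_real (\<sigma>1 / sqrt 3), 0, of_real \<sigma>2]]"

definition X_matrix :: "real \<Rightarrow> real \<Rightarrow> complex^2^2" where
  "X_matrix x y = diag_matrix (vector [of_real x, of_real y])"

definition S_matrix :: "real \<Rightarrow> real \<Rightarrow> complex^4^4" where
  "S_matrix x y = diag_matrix (vector
     [of_real x, of_real ((2 * x + y) / 3), of_real ((x + 2 * y) / 3), of_real y])"

text \<open>\<open>M_matrix \<sigma>1 \<sigma>2 x y\<close> is $M_X$ for $X = \mathrm{diag}(x, y)$.\<close>

definition M_matrix :: "real \<Rightarrow> real \<Rightarrow> real \<Rightarrow> real \<Rightarrow> complex^4^4" where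
  "M_matrix \<sigma>1 \<sigma>2 x y =
     (let T = T_matrix \<sigma>1 \<sigma>2 in
      mat 1 + conj_transpose T ** T - S_matrix x y
        - conj_transpose T ** matrix_inv (X_matrix x y) ** T)"

end

theory Submission
  imports Defs
begin

text \<open>
  Write \<open>q = g - 1\<close>. A cubic map \<open>P\<close> with \<open>P 0 = 0\<close> has coefficient vectors \<open>P\<^sub>i\<^sub>j\<close> (those of
  \<open>z\<^sub>1\<^sup>i z\<^sub>2\<^sup>j\<close>), and \<open>P/g\<close> being a sphere map is a system of linear equations for the inner
  products of these vectors. Since \<open>g\<close> is even in each variable, averaging over
  \<open>(\<plusminus> z\<^sub>1, \<plusminus> z\<^sub>2)\<close> removes all inner products between different parity classes. What is left
  after comparing coefficients (\<open>sphere_block_relations\<close>) splits into one system for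
  \<open>a = P\<^sub>1\<^sub>0, c = P\<^sub>3\<^sub>0, d = P\<^sub>1\<^sub>2\<close>, its mirror image under exchanging the variables, and the quadratic
  coefficients.

  The matrix \<open>M\<^sub>X\<close> splits in the same way: its rows and columns \<open>1, 3\<close> do not interact with \<open>2, 4\<close>,
  so \<open>M\<^sub>X \<ge> 0\<close> means that two real binary forms, \<open>Qform\<close> and its mirror image, are nonnegative.

  \<open>P\<close> gives \<open>X\<close>. Let \<open>x\<close> and \<open>y\<close> be the squared lengths of \<open>P\<^sub>1\<^sub>0\<close> and \<open>P\<^sub>0\<^sub>1\<close>. The relations express
  \<open>Qform\<close> at \<open>(u, v)\<close> as \<open>\<parallel>w\<parallel>\<^sup>2 - \<langle>a, w\<rangle>\<^sup>2 / \<parallel>a\<parallel>\<^sup>2\<close> with \<open>w = u c + v d\<close>, plus squares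
  contributed by the quadratic coefficients; by Cauchy-Schwarz it is nonnegative. A short computation
  shows that \<open>M\<^sub>X = 0\<close> only for \<open>X = I\<close>. In that case the equality case of Cauchy-Schwarz forces
  \<open>c = \<sigma>\<^sub>1 a\<close>, \<open>d = \<sigma>\<^sub>2 a\<close> and kills the quadratic part, so \<open>P\<close> is \<open>g\<close> times its linear part and the
  quotient is not reduced.

  \<open>X\<close> gives \<open>P\<close>. The two components \<open>z\<^sub>1 (x + q) / \<surd>x\<close> and \<open>z\<^sub>2 (y + q) / \<surd>y\<close> contribute to
  \<open>\<parallel>P\<parallel>\<^sup>2\<close> everything except \<open>V\<^sub>3\<^sup>* M\<^sub>X V\<^sub>3\<close>, which is a sum of squared moduli of cubics because
  \<open>M\<^sub>X \<ge> 0\<close>. A common divisor of these two components and \<open>g\<close> divides \<open>(x - 1) z\<^sub>1\<close> and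
  \<open>(y - 1) z\<^sub>2\<close> as well; since \<open>g\<close> does not vanish at the origin, it is constant unless
  \<open>x = y = 1\<close>, that is, unless \<open>M\<^sub>X = 0\<close>.
\<close>

section \<open>The matrix as a pair of binary quadratic forms\<close>

text \<open>
  The block of \<open>M\<^sub>X\<close> with rows and columns \<open>1, 3\<close>, evaluated at \<open>(u, \<surd>3 v)\<close>; the rescaling removes
  all square roots. The last term is \<open>T\<^sup>* X\<^sup>-\<^sup>1 T\<close>, the others are \<open>I + T\<^sup>* T - S\<^sub>X\<close>. The block with
  rows and columns \<open>4, 2\<close> is the same form with the roles of the two variables exchanged.
\<close>

definition Qform :: "real \<Rightarrow> real \<Rightarrow> real \<Rightarrow> real \<Rightarrow> real \<Rightarrow> real \<Rightarrow> real" where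
  "Qform s1 s2 x y u v =
     (1 + s1\<^sup>2 - x) * u\<^sup>2 + 2 * s1 * s2 * u * v + (3 + s2\<^sup>2 - x - 2 * y) * v\<^sup>2
       - (s1 * u + s2 * v)\<^sup>2 / x"

lemma vector_4 [simp]:
  "(vector [a, b, c, d] :: 'a::zero^4) $ 1 = a"
  "(vector [a, b, c, d] :: 'a::zero^4) $ 2 = b"
  "(vector [a, b, c, d] :: 'a::zero^4) $ 3 = c"
  "(vector [a, b, c, d] :: 'a::zero^4) $ 4 = d"
  unfolding vector_def by simp_all

lemma matrix_inv_eqI:
  fixes A B :: "'a::{semiring_1}^'n^'n"
  assumes "A ** B = mat 1" "B ** A = mat 1"
  shows "matrix_inv A = B"
proof -
  have "invertible A" using assms unfolding invertible_def by blast
  then have 1: "A ** matrix_inv A = mat 1" 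
    unfolding matrix_inv_def invertible_def by (metis (mono_tags, lifting) someI_ex)
  have "matrix_inv A = (B ** A) ** matrix_inv A" by (simp add: assms)
  also have "\<dots> = B" by (simp add: matrix_mul_assoc[symmetric] 1)
  finally show ?thesis .
qed

lemma matrix_inv_X_matrix:
  assumes "x \<noteq> 0" "y \<noteq> 0"
  shows "matrix_inv (X_matrix x y) = X_matrix (1 / x) (1 / y)"
  by (rule matrix_inv_eqI)
    (use assms in \<open>simp_all add: vec_eq_iff forall_2 matrix_matrix_mult_def sum_2
      X_matrix_def diag_matrix_def mat_def\<close>)

lemma M_matrix_expand:
  assumes "x \<noteq> 0" "y \<noteq> 0"
  shows "M_matrix s1 s2 x y =
    mat 1 + conj_transpose (T_matrix s1 s2) ** T_matrix s1 s2 - S_matrix x y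
      - conj_transpose (T_matrix s1 s2) ** X_matrix (1 / x) (1 / y) ** T_matrix s1 s2"
  unfolding M_matrix_def Let_def matrix_inv_X_matrix[OF assms] ..

lemma complex_sqrt_3:
  "complex_of_real (sqrt 3) * complex_of_real (sqrt 3) = 3"
  "complex_of_real (sqrt 3) * (complex_of_real (sqrt 3) * c) = 3 * c"
proof -
  show "complex_of_real (sqrt 3) * complex_of_real (sqrt 3) = 3"
    by (simp flip: of_real_mult)
  then show "complex_of_real (sqrt 3) * (complex_of_real (sqrt 3) * c) = 3 * c"
    by (simp only: mult.assoc[symmetric])
qed

lemma M_matrix_entries:
  fixes s1 s2 x y :: real
  assumes "x \<noteq> 0" "y \<noteq> 0"
  defines "M \<equiv> M_matrix s1 s2 x y"
  shows "M$1$1 = of_real (1 + s1\<^sup>2 - x - s1\<^sup>2 / x)"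
    "M$2$2 = of_real ((3 + s1\<^sup>2 - 2 * x - y - s1\<^sup>2 / y) / 3)"
    "M$3$3 = of_real ((3 + s2\<^sup>2 - x - 2 * y - s2\<^sup>2 / x) / 3)"
    "M$4$4 = of_real (1 + s2\<^sup>2 - y - s2\<^sup>2 / y)"
    "M$1$3 = of_real (s1 * s2 * (1 - 1 / x) / sqrt 3)" "M$3$1 = of_real (s1 * s2 * (1 - 1 / x) / sqrt 3)"
    "M$2$4 = of_real (s1 * s2 * (1 - 1 / y) / sqrt 3)" "M$4$2 = of_real (s1 * s2 * (1 - 1 / y) / sqrt 3)"
    "M$1$2 = 0" "M$1$4 = 0" "M$2$1 = 0" "M$2$3 = 0" "M$3$2 = 0" "M$3$4 = 0" "M$4$1 = 0" "M$4$3 = 0"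
  using assms(1,2)
  by (simp_all add: M_def M_matrix_expand[OF assms(1,2)] matrix_matrix_mult_def conj_transpose_def
      T_matrix_def S_matrix_def X_matrix_def diag_matrix_def mat_def sum_2 complex_sqrt_3
      power2_eq_square divide_simps)
    (simp_all add: algebra_simps)

text \<open>
  The entries of \<open>M\<^sub>X\<close> are real, so the real and the imaginary part of a vector contribute
  separately to the Hermitian form, and it is enough to test real vectors.
\<close>

lemma pos_semidef_M_matrix_iff:
  assumes "x > 0" "y > 0"
  shows "pos_semidef (M_matrix s1 s2 x y) \<longleftrightarrow>
    (\<forall>u v. 0 \<le> Qform s1 s2 x y u v \<and> 0 \<le> Qform s2 s1 y x u v)"
proof -
  let ?M = "M_matrix s1 s2 x y"
  note entries = M_matrix_entries[of x y s1 s2]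
  have hermitian: "conj_transpose ?M = ?M"
    using assms by (simp add: vec_eq_iff forall_4 conj_transpose_def entries)
  \<comment> \<open>the Hermitian form, as four values of real binary forms\<close>
  define F where "F w = Re (\<Sum>i\<in>UNIV. cnj (w$i) * (?M *v w)$i)" for w
  have form: "F w =
      Qform s1 s2 x y (Re (w$1)) (Re (w$3) / sqrt 3) + Qform s1 s2 x y (Im (w$1)) (Im (w$3) / sqrt 3)
      + Qform s2 s1 y x (Re (w$4)) (Re (w$2) / sqrt 3) + Qform s2 s1 y x (Im (w$4)) (Im (w$2) / sqrt 3)"
    for w
  proof -
    have "Qform a b x y u v =
        (1 + a\<^sup>2 - x - a\<^sup>2 / x) * u\<^sup>2 + 2 * (a * b * (1 - 1 / x)) * (u * v)
          + (3 + b\<^sup>2 - x - 2 * y - b\<^sup>2 / x) * v\<^sup>2" if "x > 0" for a b x y u v :: real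
      using that by (simp add: Qform_def field_simps power2_eq_square)
    then have real_form: "Qform a b x y u (v / sqrt 3) =
        (1 + a\<^sup>2 - x - a\<^sup>2 / x) * u\<^sup>2 + 2 * (a * b * (1 - 1 / x) / sqrt 3) * (u * v)
          + (3 + b\<^sup>2 - x - 2 * y - b\<^sup>2 / x) / 3 * v\<^sup>2" if "x > 0" for a b x y u v :: real
      using that by (simp add: power_divide)
    show ?thesis
      using assms
      by (simp add: F_def real_form sum_4 matrix_vector_mult_def entries power2_eq_square)
        (simp add: algebra_simps)
  qed
  show ?thesis
  proof
    assume "pos_semidef ?M"
    then have nonneg: "0 \<le> F w" for w by (simp add: pos_semidef_def F_def)
    show "\<forall>u v. 0 \<le> Qform s1 s2 x y u v \<and> 0 \<le> Qform s2 s1 y x u v"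
    proof (intro allI conjI)
      fix u v :: real
      show "0 \<le> Qform s1 s2 x y u v"
        using nonneg[of "vector [of_real u, 0, of_real (v * sqrt 3), 0]"]
        unfolding form by (simp add: Qform_def)
      show "0 \<le> Qform s2 s1 y x u v"
        using nonneg[of "vector [0, of_real (v * sqrt 3), 0, of_real u]"]
        unfolding form by (simp add: Qform_def)
    qed
  next
    assume "\<forall>u v. 0 \<le> Qform s1 s2 x y u v \<and> 0 \<le> Qform s2 s1 y x u v"
    then show "pos_semidef ?M"
      using hermitian form by (simp add: pos_semidef_def F_def)
  qed
qed

text \<open>
  The outer diagonal entries factor as \<open>(1 - x) (x - \<sigma>\<^sub>1\<^sup>2) / x\<close> and \<open>(1 - y) (y - \<sigma>\<^sub>2\<^sup>2) / y\<close>. If they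
  vanish with \<open>x \<noteq> 1\<close>, then \<open>x = \<sigma>\<^sub>1\<^sup>2 > 0\<close>, the off-diagonal entries give \<open>\<sigma>\<^sub>2 = 0\<close>, hence
  \<open>y = 1\<close>, and the third diagonal entry becomes \<open>(1 - \<sigma>\<^sub>1\<^sup>2) / 3\<close>, which is not \<open>0\<close>.
\<close>

lemma M_matrix_eq_0_iff:
  assumes "0 \<le> s1" "s1 < 1" "0 \<le> s2" "s2 < 1" "x > 0" "y > 0"
  shows "M_matrix s1 s2 x y = 0 \<longleftrightarrow> x = 1 \<and> y = 1"
proof
  let ?M = "M_matrix s1 s2 x y"
  note entries = M_matrix_entries[of x y s1 s2]
  assume M0: "?M = 0"
  have "(of_real (1 + s1\<^sup>2 - x - s1\<^sup>2 / x) :: complex) = 0"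
       "(of_real (1 + s2\<^sup>2 - y - s2\<^sup>2 / y) :: complex) = 0"
       "(of_real ((3 + s1\<^sup>2 - 2 * x - y - s1\<^sup>2 / y) / 3) :: complex) = 0"
       "(of_real ((3 + s2\<^sup>2 - x - 2 * y - s2\<^sup>2 / x) / 3) :: complex) = 0"
       "(of_real (s1 * s2 * (1 - 1 / x) / sqrt 3) :: complex) = 0"
       "(of_real (s1 * s2 * (1 - 1 / y) / sqrt 3) :: complex) = 0"
    using entries M0 assms(5,6) by (metis less_irrefl zero_index)+
  then have eqs: "1 + s1\<^sup>2 - x - s1\<^sup>2 / x = 0" "1 + s2\<^sup>2 - y - s2\<^sup>2 / y = 0"
       "3 + s1\<^sup>2 - 2 * x - y - s1\<^sup>2 / y = 0" "3 + s2\<^sup>2 - x - 2 * y - s2\<^sup>2 / x = 0"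
       "s1 * s2 * (1 - 1 / x) = 0" "s1 * s2 * (1 - 1 / y) = 0"
    by (simp_all only: of_real_eq_0_iff) simp_all
  have "(1 - x) * (x - s1\<^sup>2) = 0" "(1 - y) * (y - s2\<^sup>2) = 0"
    using eqs(1,2) assms(5,6) by (simp_all add: field_simps power2_eq_square)
  then have x: "x = 1 \<or> x = s1\<^sup>2" and y: "y = 1 \<or> y = s2\<^sup>2" by auto
  have off: "s1 = 0 \<or> s2 = 0 \<or> x = 1" "s1 = 0 \<or> s2 = 0 \<or> y = 1"
    using eqs(5,6) assms(5,6) by (auto simp: field_simps)
  have sq: "s1\<^sup>2 < 1" "s2\<^sup>2 < 1" using assms by (simp_all add: power_less_one_iff abs_square_less_1)
  show "x = 1 \<and> y = 1"
  proof (cases "x = 1")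
    case True
    moreover have "y = 1"
    proof (rule ccontr)
      assume "y \<noteq> 1"
      with y off assms(6) have "y = s2\<^sup>2" "s1 = 0" by auto
      with eqs(3) True sq show False by simp
    qed
    ultimately show ?thesis by simp
  next
    case False
    with x off assms(5) have "x = s1\<^sup>2" "s2 = 0" by auto
    with y assms(6) have "y = 1" by auto
    with eqs(4) \<open>x = s1\<^sup>2\<close> \<open>s2 = 0\<close> sq show ?thesis by simp
  qed
next
  assume "x = 1 \<and> y = 1"
  then show "M_matrix s1 s2 x y = 0"
    using M_matrix_entries[of 1 1 s1 s2] by (simp add: vec_eq_iff forall_4)
qed

section \<open>Cubic polynomials in two variables\<close>

abbreviation cf :: "nat \<Rightarrow> nat \<Rightarrow> complex poly poly \<Rightarrow> complex" where
  "cf i j p \<equiv> coeff (coeff p i) j"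

lemma total_degree_le_iff:
  "total_degree p \<le> n \<longleftrightarrow> (\<forall>i j. coeff (coeff p i) j \<noteq> 0 \<longrightarrow> i + j \<le> n)"
  unfolding total_degree_def
  by (subst Max_le_iff) (use finite_total_degree_set[of p] in auto)

lemma le_total_degree: "coeff (coeff p i) j \<noteq> 0 \<Longrightarrow> i + j \<le> total_degree p"
  using total_degree_le_iff by blast

lemma map_degree_le_iff: "map_degree P \<le> n \<longleftrightarrow> (\<forall>p\<in>set P. total_degree p \<le> n)"
  unfolding map_degree_def by (subst Max_le_iff) auto

lemma eval2_pCons: "eval2 (pCons a p) z = poly a (z$2) + z$1 * eval2 p z"
  by (simp add: eval2_def)

lemma mem_sphere_iff:
  fixes z :: "complex^2"
  shows "z \<in> sphere 0 1 \<longleftrightarrow> (cmod (z$1))\<^sup>2 + (cmod (z$2))\<^sup>2 = 1"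
  by (simp add: norm_vec_def L2_set_def sum_2 real_sqrt_eq_1_iff)

lemma g_poly_explicit: "g_poly s1 s2 = [:[:1, 0, of_real s2:], 0, [:of_real s1:]:]"
  by (simp add: g_poly_def Const_def Z1_def Z2_def power2_eq_square one_pCons)

lemma total_degree_g_poly_pos:
  assumes "(s1, s2) \<noteq> (0, 0)"
  shows "total_degree (g_poly s1 s2) > 0"
  using assms le_total_degree[of "g_poly s1 s2" 2 0] le_total_degree[of "g_poly s1 s2" 0 2]
  by (auto simp: g_poly_explicit coeff_pCons numeral_2_eq_2)

lemma cubic_expansion:
  assumes "total_degree p \<le> 3"
  shows "p = [:[:cf 0 0 p, cf 0 1 p, cf 0 2 p, cf 0 3 p:], [:cf 1 0 p, cf 1 1 p, cf 1 2 p:],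
               [:cf 2 0 p, cf 2 1 p:], [:cf 3 0 p:]:]"
proof (intro poly_eqI)
  fix i j
  have "i + j > 3 \<Longrightarrow> cf i j p = 0"
    using assms le_total_degree[of p i j] by linarith
  then show "cf i j p = cf i j [:[:cf 0 0 p, cf 0 1 p, cf 0 2 p, cf 0 3 p:], [:cf 1 0 p, cf 1 1 p, cf 1 2 p:],
               [:cf 2 0 p, cf 2 1 p:], [:cf 3 0 p:]:]"
    by (auto simp: coeff_pCons numeral_2_eq_2 numeral_3_eq_3 split: nat.split)
qed

text \<open>The shape of a polynomial \<open>g (\<alpha> z\<^sub>1 + \<beta> z\<^sub>2)\<close>, read off from its coefficients.\<close>

lemma g_poly_dvd_of_coeffs:
  assumes "total_degree p \<le> 3" "cf 0 0 p = 0" "cf 2 0 p = 0" "cf 1 1 p = 0" "cf 0 2 p = 0"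
    and "cf 3 0 p = of_real s1 * cf 1 0 p" "cf 1 2 p = of_real s2 * cf 1 0 p"
    and "cf 2 1 p = of_real s1 * cf 0 1 p" "cf 0 3 p = of_real s2 * cf 0 1 p"
  shows "g_poly s1 s2 dvd p"
proof
  show "p = g_poly s1 s2 * [:[:0, cf 0 1 p:], [:cf 1 0 p:]:]"
    using assms(2-) by (subst cubic_expansion[OF assms(1)]) (simp add: g_poly_explicit)
qed

section \<open>Inner products of coefficient vectors\<close>

text \<open>
  A function on the list of components is regarded as a vector, and the real part of the Hermitian
  product is used. Real parts suffice because all the coefficients that the argument compares are
  real.
\<close>

definition gram :: "'b list \<Rightarrow> ('b \<Rightarrow> complex) \<Rightarrow> ('b \<Rightarrow> complex) \<Rightarrow> real" where
  "gram P f h = (\<Sum>p\<leftarrow>P. f p \<bullet> h p)"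

lemma gram_commute: "gram P f h = gram P h f"
  by (simp add: gram_def inner_commute)

lemma gram_linear:
  "gram P (\<lambda>p. f p + f' p) h = gram P f h + gram P f' h"
  "gram P h (\<lambda>p. f p + f' p) = gram P h f + gram P h f'"
  "gram P (\<lambda>p. f p - f' p) h = gram P f h - gram P f' h"
  "gram P h (\<lambda>p. f p - f' p) = gram P h f - gram P h f'"
  "gram P (\<lambda>p. r *\<^sub>R f p) h = r * gram P f h"
  "gram P h (\<lambda>p. r *\<^sub>R f p) = r * gram P h f"
  by (simp_all add: gram_def inner_simps sum_list_addf sum_list_subtractf sum_list_const_mult)

lemma gram_nonneg: "0 \<le> gram P f f"
  unfolding gram_def by (rule sum_list_nonneg) auto

lemma gram_eq_0_iff: "gram P f f = 0 \<longleftrightarrow> (\<forall>p\<in>set P. f p = 0)"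
  unfolding gram_def by (subst sum_list_nonneg_eq_0_iff) auto

lemma gram_Cauchy_Schwarz:
  assumes "gram P a a > 0"
  shows "(gram P a v)\<^sup>2 / gram P a a \<le> gram P v v"
proof -
  let ?r = "gram P a v / gram P a a"
  have "0 \<le> gram P (\<lambda>p. v p - ?r *\<^sub>R a p) (\<lambda>p. v p - ?r *\<^sub>R a p)"
    by (rule gram_nonneg)
  also have "\<dots> = gram P v v - (gram P a v)\<^sup>2 / gram P a a"
    using assms unfolding gram_linear
    by (simp add: gram_commute[of P v a] field_simps power2_eq_square)
  finally show ?thesis by simp
qed

section \<open>The sphere condition on coefficients\<close>

lemma parallelogram4:
  fixes a b c d :: "'a::real_inner"
  shows "(norm (a + b + c + d))\<^sup>2 + (norm (a - b + c - d))\<^sup>2 + (norm (a + b - c - d))\<^sup>2 + (norm (a - b - c + d))\<^sup>2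
     = 4 * ((norm a)\<^sup>2 + (norm b)\<^sup>2 + (norm c)\<^sup>2 + (norm d)\<^sup>2)"
  by (simp add: power2_norm_eq_inner inner_simps inner_commute)

lemma norm_sq_scaled3:
  fixes a b c :: complex and r q :: real
  shows "(cmod (a + of_real r * b + of_real q * c))\<^sup>2 =
    a \<bullet> a + r\<^sup>2 * (b \<bullet> b) + q\<^sup>2 * (c \<bullet> c) + 2 * r * (a \<bullet> b) + 2 * q * (a \<bullet> c) + 2 * r * q * (b \<bullet> c)"
  unfolding power2_norm_eq_inner scaleR_conv_of_real[symmetric]
  by (simp add: inner_add_left inner_add_right inner_commute[of b a] inner_commute[of c a] inner_commute[of c b] power2_eq_square algebra_simps)

text \<open>
  The four terms on the right are the parity classes of \<open>p\<close>; changing signs of the coordinates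
  changes their relative signs, so by the parallelogram law their mixed products cancel. The squares
  of the coordinates are chosen real, which makes the result a real polynomial identity in
  \<open>s, t, \<xi>, \<eta>\<close>. The summand \<open>0\<close> gives the third term the same form as the first two.
\<close>

lemma cubic_sign_average:
  assumes "total_degree p \<le> 3" "eval2 p 0 = 0"
    and w1: "w1\<^sup>2 = of_real (\<xi> * s)" and w2: "w2\<^sup>2 = of_real (\<eta> * t)"
    and s: "(cmod w1)\<^sup>2 = s" and t: "(cmod w2)\<^sup>2 = t"
  shows "(cmod (eval2 p (vector [w1, w2])))\<^sup>2 + (cmod (eval2 p (vector [- w1, w2])))\<^sup>2
       + (cmod (eval2 p (vector [w1, - w2])))\<^sup>2 + (cmod (eval2 p (vector [- w1, - w2])))\<^sup>2 =
    4 * (s * (cmod (cf 1 0 p + of_real (\<xi> * s) * cf 3 0 p + of_real (\<eta> * t) * cf 1 2 p))\<^sup>2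
       + t * (cmod (cf 0 1 p + of_real (\<xi> * s) * cf 2 1 p + of_real (\<eta> * t) * cf 0 3 p))\<^sup>2
       + (cmod (0 + of_real (\<xi> * s) * cf 2 0 p + of_real (\<eta> * t) * cf 0 2 p))\<^sup>2
       + s * t * (cmod (cf 1 1 p))\<^sup>2)"
proof -
  have "cf 0 0 p = 0"
    using assms(2) by (simp add: eval2_def poly_0_coeff_0)
  then have expand: "eval2 p z =
      z$1 * (cf 1 0 p + (z$1)\<^sup>2 * cf 3 0 p + (z$2)\<^sup>2 * cf 1 2 p)
      + z$2 * (cf 0 1 p + (z$1)\<^sup>2 * cf 2 1 p + (z$2)\<^sup>2 * cf 0 3 p)
      + ((z$1)\<^sup>2 * cf 2 0 p + (z$2)\<^sup>2 * cf 0 2 p) + z$1 * z$2 * cf 1 1 p" for z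
    by (subst cubic_expansion[OF assms(1)])
      (simp add: eval2_pCons, simp add: algebra_simps power2_eq_square)
  define A where "A = w1 * (cf 1 0 p + of_real (\<xi> * s) * cf 3 0 p + of_real (\<eta> * t) * cf 1 2 p)"
  define B where "B = w2 * (cf 0 1 p + of_real (\<xi> * s) * cf 2 1 p + of_real (\<eta> * t) * cf 0 3 p)"
  define C where "C = 0 + of_real (\<xi> * s) * cf 2 0 p + of_real (\<eta> * t) * cf 0 2 p"
  define D where "D = w1 * w2 * cf 1 1 p"
  have "eval2 p (vector [w1, w2]) = A + B + C + D" "eval2 p (vector [- w1, w2]) = - (A - B - C + D)"
    "eval2 p (vector [w1, - w2]) = A - B + C - D" "eval2 p (vector [- w1, - w2]) = - (A + B - C - D)"
    unfolding expand A_def B_def C_def D_def by (simp_all add: w1 w2)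
  then have "(cmod (eval2 p (vector [w1, w2])))\<^sup>2 + (cmod (eval2 p (vector [- w1, w2])))\<^sup>2
       + (cmod (eval2 p (vector [w1, - w2])))\<^sup>2 + (cmod (eval2 p (vector [- w1, - w2])))\<^sup>2 =
      4 * ((cmod A)\<^sup>2 + (cmod B)\<^sup>2 + (cmod C)\<^sup>2 + (cmod D)\<^sup>2)"
    using parallelogram4[of A B C D] by (simp only: norm_minus_cancel)
  then show ?thesis
    by (simp only: A_def B_def C_def D_def norm_mult power_mult_distrib s t)
qed

lemma real_square_point:
  fixes \<xi> s :: real
  assumes "s \<ge> 0" "\<xi> \<in> {-1, 1}"
  obtains w :: complex where "w\<^sup>2 = of_real (\<xi> * s)" "(cmod w)\<^sup>2 = s"
proof
  show "(csqrt (of_real (\<xi> * s)))\<^sup>2 = of_real (\<xi> * s)" by simp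
  have "(cmod (csqrt (of_real (\<xi> * s))))\<^sup>2 = cmod ((csqrt (of_real (\<xi> * s)))\<^sup>2)"
    by (simp only: norm_power)
  then show "(cmod (csqrt (of_real (\<xi> * s))))\<^sup>2 = s" using assms by auto
qed

lemma averaged_sphere_identity:
  assumes cubic: "\<And>p. p \<in> set P \<Longrightarrow> total_degree p \<le> 3"
    and vanish: "\<And>p. p \<in> set P \<Longrightarrow> eval2 p 0 = 0"
    and sphere: "\<And>z. z \<in> sphere 0 1 \<Longrightarrow> (\<Sum>p\<leftarrow>P. (cmod (eval2 p z))\<^sup>2) = (cmod (eval2 (g_poly s1 s2) z))\<^sup>2"
    and st: "s \<ge> 0" "t \<ge> 0" "s + t = 1" and signs: "\<xi> \<in> {-1, 1}" "\<eta> \<in> {-1, 1}"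
  defines "G \<equiv> gram P"
  shows "s * (G (cf 1 0) (cf 1 0) + s\<^sup>2 * G (cf 3 0) (cf 3 0) + t\<^sup>2 * G (cf 1 2) (cf 1 2)
        + 2 * s * \<xi> * G (cf 1 0) (cf 3 0) + 2 * t * \<eta> * G (cf 1 0) (cf 1 2) + 2 * s * t * \<xi> * \<eta> * G (cf 3 0) (cf 1 2))
      + t * (G (cf 0 1) (cf 0 1) + s\<^sup>2 * G (cf 2 1) (cf 2 1) + t\<^sup>2 * G (cf 0 3) (cf 0 3)
        + 2 * s * \<xi> * G (cf 0 1) (cf 2 1) + 2 * t * \<eta> * G (cf 0 1) (cf 0 3) + 2 * s * t * \<xi> * \<eta> * G (cf 2 1) (cf 0 3))
      + (s\<^sup>2 * G (cf 2 0) (cf 2 0) + t\<^sup>2 * G (cf 0 2) (cf 0 2) + 2 * s * t * \<xi> * \<eta> * G (cf 2 0) (cf 0 2))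
      + s * t * G (cf 1 1) (cf 1 1)
    = 1 + s\<^sup>2 * s1\<^sup>2 + t\<^sup>2 * s2\<^sup>2 + 2 * s * \<xi> * s1 + 2 * t * \<eta> * s2 + 2 * s * t * \<xi> * \<eta> * (s1 * s2)"
    (is "?lhs = ?rhs")
proof -
  obtain w1 :: complex where w1: "w1\<^sup>2 = of_real (\<xi> * s)" "(cmod w1)\<^sup>2 = s"
    using real_square_point st(1) signs(1) by blast
  obtain w2 :: complex where w2: "w2\<^sup>2 = of_real (\<eta> * t)" "(cmod w2)\<^sup>2 = t"
    using real_square_point st(2) signs(2) by blast
  \<comment> \<open>the four points share the squares of their coordinates, hence the value of \<open>g\<close>\<close>
  let ?Z = "[vector [w1, w2], vector [- w1, w2], vector [w1, - w2], vector [- w1, - w2]] :: (complex^2) list"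
  have value_g: "(\<Sum>p\<leftarrow>P. (cmod (eval2 p z))\<^sup>2) = (1 + s1 * \<xi> * s + s2 * \<eta> * t)\<^sup>2"
    if "z \<in> set ?Z" for z
  proof -
    have sq: "(z$1)\<^sup>2 = of_real (\<xi> * s)" "(z$2)\<^sup>2 = of_real (\<eta> * t)"
         "(cmod (z$1))\<^sup>2 = s" "(cmod (z$2))\<^sup>2 = t"
      using that w1 w2 by auto
    then have "z \<in> sphere 0 1" using st by (simp only: mem_sphere_iff)
    moreover have "eval2 (g_poly s1 s2) z = of_real (1 + s1 * \<xi> * s + s2 * \<eta> * t)"
      by (simp add: eval2_g_poly sq)
    ultimately show ?thesis by (simp only: sphere norm_of_real power2_abs)
  qed
  have sq: "\<xi>\<^sup>2 = 1" "\<eta>\<^sup>2 = 1" using signs by auto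
  define N where "N p = s * (cmod (cf 1 0 p + of_real (\<xi> * s) * cf 3 0 p + of_real (\<eta> * t) * cf 1 2 p))\<^sup>2
       + t * (cmod (cf 0 1 p + of_real (\<xi> * s) * cf 2 1 p + of_real (\<eta> * t) * cf 0 3 p))\<^sup>2
       + (cmod (0 + of_real (\<xi> * s) * cf 2 0 p + of_real (\<eta> * t) * cf 0 2 p))\<^sup>2
       + s * t * (cmod (cf 1 1 p))\<^sup>2" for p
  have "4 * (\<Sum>p\<leftarrow>P. N p) = (\<Sum>p\<leftarrow>P. (cmod (eval2 p (vector [w1, w2])))\<^sup>2 + (cmod (eval2 p (vector [- w1, w2])))\<^sup>2
       + (cmod (eval2 p (vector [w1, - w2])))\<^sup>2 + (cmod (eval2 p (vector [- w1, - w2])))\<^sup>2)"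
    unfolding sum_list_const_mult[symmetric] N_def
    by (intro arg_cong[of _ _ sum_list] map_cong refl cubic_sign_average[symmetric] w1 w2 cubic vanish)
  also have "\<dots> = 4 * (1 + s1 * \<xi> * s + s2 * \<eta> * t)\<^sup>2"
    unfolding sum_list_addf using value_g by simp
  finally have "(\<Sum>p\<leftarrow>P. N p) = (1 + s1 * \<xi> * s + s2 * \<eta> * t)\<^sup>2" by simp
  moreover have "(\<Sum>p\<leftarrow>P. N p) = ?lhs"
    unfolding N_def norm_sq_scaled3 power2_norm_eq_inner[of "cf 1 1 _"] G_def gram_def sum_list_addf sum_list_const_mult
      power_mult_distrib sq
    by (simp add: algebra_simps)
  moreover have "(1 + s1 * \<xi> * s + s2 * \<eta> * t)\<^sup>2 = ?rhs"
    using signs by (auto simp: power2_eq_square algebra_simps)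
  ultimately show ?thesis by simp
qed

text \<open>
  On \<open>s + t = 1\<close> both sides can be made homogeneous, so comparing coefficients is legitimate. The signs
  \<open>\<xi>, \<eta>\<close> separate four parts; the part without signs is a cubic form in \<open>(s, t)\<close>, whose four
  coefficients are determined by its values at four points, and the other parts need fewer.
\<close>

lemma cubic_sign_coefficients:
  fixes x y C D C' D' B E m ac ad cd ac' ad' cd' be s1 s2 :: real
  assumes id: "\<And>s t \<xi> \<eta> :: real. s \<ge> 0 \<Longrightarrow> t \<ge> 0 \<Longrightarrow> s + t = 1 \<Longrightarrow> \<xi> \<in> {-1, 1} \<Longrightarrow> \<eta> \<in> {-1, 1} \<Longrightarrow>
      s * (x + s\<^sup>2 * C + t\<^sup>2 * D + 2 * s * \<xi> * ac + 2 * t * \<eta> * ad + 2 * s * t * \<xi> * \<eta> * cd)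
      + t * (y + s\<^sup>2 * D' + t\<^sup>2 * C' + 2 * s * \<xi> * ad' + 2 * t * \<eta> * ac' + 2 * s * t * \<xi> * \<eta> * cd')
      + (s\<^sup>2 * B + t\<^sup>2 * E + 2 * s * t * \<xi> * \<eta> * be) + s * t * m
    = 1 + s\<^sup>2 * s1\<^sup>2 + t\<^sup>2 * s2\<^sup>2 + 2 * s * \<xi> * s1 + 2 * t * \<eta> * s2 + 2 * s * t * \<xi> * \<eta> * (s1 * s2)"
  shows "x + B + C = 1 + s1\<^sup>2" "x + 2 * y + m + E + D = 3 + s2\<^sup>2" "ac = s1" "ad = s2" "be + cd = s1 * s2"
    "y + E + C' = 1 + s2\<^sup>2" "y + 2 * x + m + B + D' = 3 + s1\<^sup>2" "ac' = s2" "ad' = s1" "be + cd' = s1 * s2"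
proof -
  note id' = id[unfolded power2_eq_square]
  note at_1_0 = id'[of 1 0 1 1, simplified] id'[of 1 0 "-1" 1, simplified]
  note at_0_1 = id'[of 0 1 1 1, simplified] id'[of 0 1 1 "-1", simplified]
  note at_half = id'[of "1/2" "1/2" 1 1, simplified] id'[of "1/2" "1/2" 1 "-1", simplified]
    id'[of "1/2" "1/2" "-1" 1, simplified] id'[of "1/2" "1/2" "-1" "-1", simplified]
  note at_third = id'[of "1/3" "2/3" 1 1, simplified] id'[of "1/3" "2/3" 1 "-1", simplified]
    id'[of "1/3" "2/3" "-1" 1, simplified] id'[of "1/3" "2/3" "-1" "-1", simplified]
  have half: "(x + C / 4 + D / 4) / 2 + (y + D' / 4 + C' / 4) / 2 + B / 4 + E / 4 + m / 4 = 1 + s1 * s1 / 4 + s2 * s2 / 4"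
    using at_half by argo
  have half_odd: "ac + ad' = 2 * s1" "ad + ac' = 2 * s2"
    subgoal using at_half by argo
    subgoal using at_half by argo
    done
  have half_mixed: "cd + cd' + 2 * be = 2 * (s1 * s2)" using at_half by argo
  have third: "(x + C / 9 + 4 * D / 9) / 3 + 2 * (y + D' / 9 + 4 * C' / 9) / 3 + B / 9 + 4 * E / 9 + 2 * m / 9
      = 1 + s1 * s1 / 9 + 4 * (s2 * s2) / 9"
    using at_third by argo
  have third_odd: "ac + 2 * ad' = 3 * s1" "ad + 2 * ac' = 3 * s2"
    subgoal using at_third by argo
    subgoal using at_third by argo
    done
  have third_mixed: "cd + 2 * cd' + 3 * be = 3 * (s1 * s2)" using at_third by argo
  have ends: "x + B + C = 1 + s1 * s1" "y + E + C' = 1 + s2 * s2"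
    using at_1_0 at_0_1 by linarith+
  show "x + B + C = 1 + s1\<^sup>2" "y + E + C' = 1 + s2\<^sup>2"
    unfolding power2_eq_square by (fact ends)+
  show "x + 2 * y + m + E + D = 3 + s2\<^sup>2"
    unfolding power2_eq_square using half third ends by argo
  show "y + 2 * x + m + B + D' = 3 + s1\<^sup>2"
    unfolding power2_eq_square using half third ends by argo
  show "ac = s1" "ad = s2" "ac' = s2" "ad' = s1"
    using half_odd third_odd by linarith+
  show "be + cd = s1 * s2" "be + cd' = s1 * s2"
    using half_mixed third_mixed by linarith+
qed

text \<open>
  What the sphere condition says about one parity class: \<open>a, c, d\<close> are the coefficient vectors of
  \<open>z\<^sub>1, z\<^sub>1\<^sup>3, z\<^sub>1 z\<^sub>2\<^sup>2\<close> (or of their mirror images), and \<open>b, m, e\<close> those of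
  \<open>z\<^sub>1\<^sup>2, z\<^sub>1 z\<^sub>2, z\<^sub>2\<^sup>2\<close> (or of \<open>z\<^sub>2\<^sup>2, z\<^sub>1 z\<^sub>2, z\<^sub>1\<^sup>2\<close>). The number \<open>y\<close> is the squared length of the
  other linear coefficient.
\<close>

definition block_relations ::
    "complex poly poly list \<Rightarrow> real \<Rightarrow> real \<Rightarrow> real \<Rightarrow> (complex poly poly \<Rightarrow> complex) \<Rightarrow> (complex poly poly \<Rightarrow> complex)
      \<Rightarrow> (complex poly poly \<Rightarrow> complex) \<Rightarrow> (complex poly poly \<Rightarrow> complex) \<Rightarrow> (complex poly poly \<Rightarrow> complex)
      \<Rightarrow> (complex poly poly \<Rightarrow> complex) \<Rightarrow> bool" where
  "block_relations P s1 s2 y a b m e c d \<longleftrightarrow>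
     gram P a a + gram P b b + gram P c c = 1 + s1\<^sup>2 \<and>
     gram P a a + 2 * y + gram P m m + gram P e e + gram P d d = 3 + s2\<^sup>2 \<and>
     gram P a c = s1 \<and> gram P a d = s2 \<and> gram P b e + gram P c d = s1 * s2"

lemma sphere_block_relations:
  assumes cubic: "\<And>p. p \<in> set P \<Longrightarrow> total_degree p \<le> 3"
    and vanish: "\<And>p. p \<in> set P \<Longrightarrow> eval2 p 0 = 0"
    and sphere: "\<And>z. z \<in> sphere 0 1 \<Longrightarrow> (\<Sum>p\<leftarrow>P. (cmod (eval2 p z))\<^sup>2) = (cmod (eval2 (g_poly s1 s2) z))\<^sup>2"
  shows "block_relations P s1 s2 (gram P (cf 0 1) (cf 0 1)) (cf 1 0) (cf 2 0) (cf 1 1) (cf 0 2) (cf 3 0) (cf 1 2)"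
    and "block_relations P s2 s1 (gram P (cf 1 0) (cf 1 0)) (cf 0 1) (cf 0 2) (cf 1 1) (cf 2 0) (cf 0 3) (cf 2 1)"
proof -
  have relations:
    "block_relations P s1 s2 (gram P (cf 0 1) (cf 0 1)) (cf 1 0) (cf 2 0) (cf 1 1) (cf 0 2) (cf 3 0) (cf 1 2) \<and>
     block_relations P s2 s1 (gram P (cf 1 0) (cf 1 0)) (cf 0 1) (cf 0 2) (cf 1 1) (cf 2 0) (cf 0 3) (cf 2 1)"
    unfolding block_relations_def gram_commute[of P "cf 0 2" "cf 2 0"] gram_commute[of P "cf 0 3" "cf 2 1"]
      mult.commute[of s2 s1]
    by (intro conjI; rule cubic_sign_coefficients, rule averaged_sphere_identity[OF cubic vanish sphere]; assumption)
  show "block_relations P s1 s2 (gram P (cf 0 1) (cf 0 1)) (cf 1 0) (cf 2 0) (cf 1 1) (cf 0 2) (cf 3 0) (cf 1 2)"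
    using relations by blast
  show "block_relations P s2 s1 (gram P (cf 1 0) (cf 1 0)) (cf 0 1) (cf 0 2) (cf 1 1) (cf 2 0) (cf 0 3) (cf 2 1)"
    using relations by blast
qed

section \<open>From a sphere map to the matrix inequality\<close>

text \<open>Some product of \<open>a\<close> with another vector is nonzero, so \<open>a\<close> is not the zero vector.\<close>

lemma block_diagonal_pos:
  assumes "block_relations P s1 s2 y a b m e c d" "(s1, s2) \<noteq> (0, 0)"
  shows "gram P a a > 0"
proof (rule ccontr)
  assume "\<not> gram P a a > 0"
  then have "gram P a a = 0" using gram_nonneg[of P a] by linarith
  then have "\<forall>p\<in>set P. a p = 0" by (simp add: gram_eq_0_iff)
  then have "gram P a h = 0" for h
    unfolding gram_def by (simp cong: map_cong)
  with assms show False by (simp add: block_relations_def)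
qed

text \<open>
  The relations turn \<open>Qform\<close> into the Cauchy-Schwarz defect of \<open>a\<close> and \<open>u c + v d\<close>, plus the squared
  lengths of \<open>u b + v e\<close> and \<open>v m\<close>.
\<close>

lemma Qform_nonneg_of_block_relations:
  assumes rel: "block_relations P s1 s2 y a b m e c d" and pos: "gram P a a > 0"
  shows "0 \<le> Qform s1 s2 (gram P a a) y u v"
proof -
  let ?x = "gram P a a"
  let ?C = "\<lambda>p. u *\<^sub>R c p + v *\<^sub>R d p" and ?B = "\<lambda>p. u *\<^sub>R b p + v *\<^sub>R e p"
  have cross: "gram P a ?C = s1 * u + s2 * v"
    using rel by (simp add: gram_linear block_relations_def)
  have square: "gram P ?C ?C + gram P ?B ?B + v\<^sup>2 * gram P m m =
      u\<^sup>2 * (gram P b b + gram P c c) + 2 * u * v * (gram P b e + gram P c d)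
      + v\<^sup>2 * (gram P m m + gram P e e + gram P d d)"
    by (simp add: gram_linear gram_commute[of P d c] gram_commute[of P e b] power2_eq_square algebra_simps)
  have sizes: "gram P b b + gram P c c = 1 + s1\<^sup>2 - ?x"
    "gram P m m + gram P e e + gram P d d = 3 + s2\<^sup>2 - ?x - 2 * y"
    "gram P b e + gram P c d = s1 * s2"
    using rel by (simp_all add: block_relations_def)
  have "Qform s1 s2 ?x y u v =
      (gram P ?C ?C + gram P ?B ?B + v\<^sup>2 * gram P m m) - (gram P a ?C)\<^sup>2 / ?x"
    unfolding Qform_def square sizes cross by (simp add: algebra_simps)
  moreover have "0 \<le> v\<^sup>2 * gram P m m" by (simp add: gram_nonneg)
  ultimately show ?thesis
    using gram_Cauchy_Schwarz[OF pos, of ?C] gram_nonneg[of P ?B] by linarith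
qed

text \<open>
  For \<open>x = y = 1\<close> the relations leave no room: \<open>\<parallel>c - \<sigma>\<^sub>1 a\<parallel>\<^sup>2 + \<parallel>b\<parallel>\<^sup>2\<close> and
  \<open>\<parallel>d - \<sigma>\<^sub>2 a\<parallel>\<^sup>2 + \<parallel>m\<parallel>\<^sup>2 + \<parallel>e\<parallel>\<^sup>2\<close> both evaluate to \<open>0\<close>.
\<close>

lemma block_relations_rigid:
  assumes rel: "block_relations P s1 s2 1 a b m e c d" and one: "gram P a a = 1" and p: "p \<in> set P"
  shows "c p = of_real s1 * a p" "d p = of_real s2 * a p" "b p = 0" "e p = 0" "m p = 0"
proof -
  have "gram P (\<lambda>p. c p - s1 *\<^sub>R a p) (\<lambda>p. c p - s1 *\<^sub>R a p) + gram P b b = 0"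
    using rel one
    by (simp add: gram_linear block_relations_def gram_commute[of P c a] power2_eq_square)
  moreover have "gram P (\<lambda>p. d p - s2 *\<^sub>R a p) (\<lambda>p. d p - s2 *\<^sub>R a p) + gram P m m + gram P e e = 0"
    using rel one
    by (simp add: gram_linear block_relations_def gram_commute[of P d a] power2_eq_square)
  ultimately have "gram P (\<lambda>p. c p - s1 *\<^sub>R a p) (\<lambda>p. c p - s1 *\<^sub>R a p) = 0"
    "gram P (\<lambda>p. d p - s2 *\<^sub>R a p) (\<lambda>p. d p - s2 *\<^sub>R a p) = 0"
    "gram P b b = 0" "gram P e e = 0" "gram P m m = 0"
    using gram_nonneg[of P "\<lambda>p. c p - s1 *\<^sub>R a p"] gram_nonneg[of P "\<lambda>p. d p - s2 *\<^sub>R a p"]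
      gram_nonneg[of P b] gram_nonneg[of P e] gram_nonneg[of P m] by linarith+
  then show "c p = of_real s1 * a p" "d p = of_real s2 * a p" "b p = 0" "e p = 0" "m p = 0"
    using p by (auto simp: gram_eq_0_iff scaleR_conv_of_real)
qed

lemma sphere_map_imp_M_matrix:
  assumes s: "0 \<le> s1" "s1 < 1" "0 \<le> s2" "s2 < 1" "(s1, s2) \<noteq> (0, 0)"
    and vanish: "\<And>p. p \<in> set P \<Longrightarrow> eval2 p 0 = 0" and deg: "map_degree P \<le> 3"
    and sphere: "sphere_map P (g_poly s1 s2)" and reduced: "reduced_quotient P (g_poly s1 s2)"
  shows "\<exists>x y. x > 0 \<and> y > 0 \<and> pos_semidef (M_matrix s1 s2 x y) \<and> M_matrix s1 s2 x y \<noteq> 0"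
proof -
  have cubic: "total_degree p \<le> 3" if "p \<in> set P" for p
    using deg that by (simp add: map_degree_le_iff)
  have norms: "(\<Sum>p\<leftarrow>P. (cmod (eval2 p z))\<^sup>2) = (cmod (eval2 (g_poly s1 s2) z))\<^sup>2" if "z \<in> sphere 0 1" for z
    using sphere that by (simp add: sphere_map_def)
  define x where "x = gram P (cf 1 0) (cf 1 0)"
  define y where "y = gram P (cf 0 1) (cf 0 1)"
  note rel = sphere_block_relations[OF cubic vanish norms, folded x_def y_def]
  have pos: "x > 0" "y > 0"
    using block_diagonal_pos[OF rel(1)] block_diagonal_pos[OF rel(2)] s(5) by (auto simp: x_def y_def)
  have "pos_semidef (M_matrix s1 s2 x y)"
    unfolding pos_semidef_M_matrix_iff[OF pos]
    using Qform_nonneg_of_block_relations[OF rel(1)] Qform_nonneg_of_block_relations[OF rel(2)] pos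
    by (simp add: x_def y_def)
  moreover have "M_matrix s1 s2 x y \<noteq> 0"
  proof
    assume "M_matrix s1 s2 x y = 0"
    \<comment> \<open>both blocks are rigid, so \<open>g\<close> divides every component\<close>
    then have one: "x = 1" "y = 1" using M_matrix_eq_0_iff s pos by auto
    have "g_poly s1 s2 dvd p" if p: "p \<in> set P" for p
    proof (rule g_poly_dvd_of_coeffs)
      show "cf 0 0 p = 0"
        using vanish[OF p] by (simp add: eval2_def poly_0_coeff_0)
    qed (use cubic p block_relations_rigid[OF rel(1)[unfolded one] one(1)[unfolded x_def] p]
        block_relations_rigid[OF rel(2)[unfolded one] one(2)[unfolded y_def] p] in auto)
    with reduced total_degree_g_poly_pos[OF s(5)] show False
      unfolding reduced_quotient_def using dvd_refl by blast
  qed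
  ultimately show ?thesis using pos by blast
qed

section \<open>Holomorphy of the quotients\<close>

definition complex_derivable_at :: "(complex^2 \<Rightarrow> complex) \<Rightarrow> complex^2 \<Rightarrow> bool" where
  "complex_derivable_at f z \<longleftrightarrow> (\<exists>a b. (f has_derivative (\<lambda>h. a * h$1 + b * h$2)) (at z))"

lemma complex_derivable_const: "complex_derivable_at (\<lambda>z. c) z"
  unfolding complex_derivable_at_def by (rule exI[of _ 0], rule exI[of _ 0]) simp

lemma complex_derivable_coord:
  "complex_derivable_at (\<lambda>z. z$1) z" "complex_derivable_at (\<lambda>z. z$2) z"
  unfolding complex_derivable_at_def
  by (rule exI[of _ 1], rule exI[of _ 0], simp add: bounded_linear_imp_has_derivative[OF bounded_linear_vec_nth])
     (rule exI[of _ 0], rule exI[of _ 1], simp add: bounded_linear_imp_has_derivative[OF bounded_linear_vec_nth])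

lemma complex_derivable_add:
  assumes "complex_derivable_at f z" "complex_derivable_at h z"
  shows "complex_derivable_at (\<lambda>z. f z + h z) z"
proof -
  obtain a b a' b' where d: "(f has_derivative (\<lambda>k. a * k$1 + b * k$2)) (at z)"
      "(h has_derivative (\<lambda>k. a' * k$1 + b' * k$2)) (at z)"
    using assms unfolding complex_derivable_at_def by blast
  have "((\<lambda>z. f z + h z) has_derivative (\<lambda>k. (a + a') * k$1 + (b + b') * k$2)) (at z)"
    by (rule has_derivative_eq_rhs[OF has_derivative_add[OF d]]) (simp add: fun_eq_iff algebra_simps)
  then show ?thesis unfolding complex_derivable_at_def by blast
qed

lemma complex_derivable_mult:
  assumes "complex_derivable_at f z" "complex_derivable_at h z"
  shows "complex_derivable_at (\<lambda>z. f z * h z) z"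
proof -
  obtain a b a' b' where d: "(f has_derivative (\<lambda>k. a * k$1 + b * k$2)) (at z)"
      "(h has_derivative (\<lambda>k. a' * k$1 + b' * k$2)) (at z)"
    using assms unfolding complex_derivable_at_def by blast
  have "((\<lambda>z. f z * h z) has_derivative (\<lambda>k. (f z * a' + a * h z) * k$1 + (f z * b' + b * h z) * k$2)) (at z)"
    by (rule has_derivative_eq_rhs[OF has_derivative_mult[OF d]]) (simp add: fun_eq_iff algebra_simps)
  then show ?thesis unfolding complex_derivable_at_def by blast
qed

lemma complex_derivable_inverse:
  assumes "complex_derivable_at f z" "f z \<noteq> 0"
  shows "complex_derivable_at (\<lambda>z. inverse (f z)) z"
proof -
  obtain a b where d: "(f has_derivative (\<lambda>k. a * k$1 + b * k$2)) (at z)"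
    using assms unfolding complex_derivable_at_def by blast
  have "((\<lambda>z. inverse (f z)) has_derivative
      (\<lambda>k. - (inverse (f z) * a * inverse (f z)) * k$1 + - (inverse (f z) * b * inverse (f z)) * k$2)) (at z)"
    by (rule has_derivative_eq_rhs[OF Deriv.has_derivative_inverse[OF assms(2) d]]) (simp add: fun_eq_iff algebra_simps)
  then show ?thesis unfolding complex_derivable_at_def by blast
qed

lemma complex_derivable_eval2: "complex_derivable_at (eval2 p) z"
proof -
  have inner: "complex_derivable_at (\<lambda>z. poly a (z$2)) z" for a
    by (induction a) (auto intro!: complex_derivable_const complex_derivable_add complex_derivable_mult complex_derivable_coord)
  show ?thesis
  proof (induction p)
    case 0
    then show ?case using complex_derivable_const[of 0 z] by (simp add: eval2_def)
  next
    case (pCons a p)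
    have "eval2 (pCons a p) = (\<lambda>z. poly a (z$2) + z$1 * eval2 p z)"
      by (rule ext) (rule eval2_pCons)
    then show ?case
      by (simp only:) (intro complex_derivable_add inner complex_derivable_mult complex_derivable_coord pCons.IH)
  qed
qed

lemma rational_holomorphic_if_nonzero:
  assumes "\<And>z. z \<in> U \<Longrightarrow> eval2 g z \<noteq> 0" "g \<noteq> 0"
  shows "rational_holomorphic_on p g U"
  unfolding rational_holomorphic_on_def holomorphic2_on_def complex_derivable_at_def[symmetric]
  using assms
  by (intro conjI exI[of _ "\<lambda>z. eval2 p z * inverse (eval2 g z)"] ballI
      complex_derivable_mult complex_derivable_inverse complex_derivable_eval2) auto

lemma g_poly_nonzero_on_ball:
  assumes "0 \<le> s1" "s1 < 1" "0 \<le> s2" "s2 < 1" and z: "z \<in> ball 0 1"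
  shows "eval2 (g_poly s1 s2) z \<noteq> 0"
proof
  assume "eval2 (g_poly s1 s2) z = 0"
  then have "- 1 = of_real s1 * (z$1)\<^sup>2 + of_real s2 * (z$2)\<^sup>2"
    by (metis add.assoc add_eq_0_iff eval2_g_poly minus_add_cancel minus_minus)
  then have "1 = cmod (of_real s1 * (z$1)\<^sup>2 + of_real s2 * (z$2)\<^sup>2)"
    by (metis norm_minus_cancel norm_one)
  also have "\<dots> \<le> s1 * (cmod (z$1))\<^sup>2 + s2 * (cmod (z$2))\<^sup>2"
    by (rule order_trans[OF norm_triangle_ineq]) (use assms in \<open>simp add: norm_mult norm_power\<close>)
  also have "\<dots> \<le> (cmod (z$1))\<^sup>2 + (cmod (z$2))\<^sup>2"
    using assms by (intro add_mono mult_left_le_one_le) auto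
  also have "\<dots> < 1"
    using z by (simp add: norm_vec_def L2_set_def sum_2)
  finally show False by simp
qed

section \<open>Common divisors\<close>

text \<open>
  A factor of \<open>z\<^sub>1\<close> that does not vanish at the origin leaves the zero to its cofactor, which therefore
  has all of the degree of \<open>z\<^sub>1\<close>.
\<close>

lemma dvd_Z1_total_degree_0:
  assumes "h dvd Z1" "eval2 h 0 \<noteq> 0"
  shows "total_degree h = 0"
proof -
  obtain k where hk: "Z1 = h * k" using assms(1) by (rule dvdE)
  have nz: "h \<noteq> 0" "k \<noteq> 0" using hk by (auto simp: Z1_def)
  have deg: "degree h + degree k = 1"
    using degree_mult_eq[OF nz] hk by (simp add: Z1_def)
  have "degree k \<noteq> 0"
  proof
    assume "degree k = 0"
    then obtain k0 where k: "k = [:k0:]" by (rule degree_eq_zeroE)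
    have "coeff h 0 * k0 = 0"
      using arg_cong[OF hk, of "\<lambda>p. coeff p 0"] by (simp add: k Z1_def coeff_mult mult.commute)
    with nz k assms(2) show False by (auto simp: eval2_def poly_0_coeff_0 mult_eq_0_iff)
  qed
  with deg have "degree h = 0" by simp
  then obtain h0 where h: "h = [:h0:]" by (rule degree_eq_zeroE)
  have "h0 * coeff k 1 = 1"
    using arg_cong[OF hk, of "\<lambda>p. coeff p 1"] by (simp add: h Z1_def)
  then have "h0 dvd 1" by (metis dvd_triv_left)
  then have "degree h0 = 0" by (auto simp: is_unit_poly_iff)
  then show ?thesis
    using total_degree_le_iff[of h 0] by (auto simp: h coeff_pCons coeff_eq_0 split: nat.splits)
qed

lemma dvd_Z2_total_degree_0:
  assumes "h dvd Z2" "eval2 h 0 \<noteq> 0"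
  shows "total_degree h = 0"
proof -
  obtain k where hk: "Z2 = h * k" using assms(1) by (rule dvdE)
  have nz: "h \<noteq> 0" "k \<noteq> 0" using hk by (auto simp: Z2_def)
  have "degree h + degree k = 0"
    using degree_mult_eq[OF nz] hk by (simp add: Z2_def)
  then obtain h0 k0 where h: "h = [:h0:]" and k: "k = [:k0:]"
    by (metis add_is_0 degree_eq_zeroE)
  have hk0: "[:0, 1:] = h0 * k0" using hk by (simp add: h k Z2_def)
  have nz0: "h0 \<noteq> 0" "k0 \<noteq> 0" using hk0 by auto
  have "degree h0 + degree k0 = 1"
    using degree_mult_eq[OF nz0] by (simp flip: hk0)
  moreover have "degree k0 \<noteq> 0"
  proof
    assume "degree k0 = 0"
    then obtain c where c: "k0 = [:c:]" by (rule degree_eq_zeroE)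
    have "coeff h0 0 * c = 0"
      using arg_cong[OF hk0, of "\<lambda>p. coeff p 0"] by (simp add: c coeff_mult mult.commute)
    with nz0 c h assms(2) show False by (auto simp: eval2_def poly_0_coeff_0 mult_eq_0_iff)
  qed
  ultimately have "degree h0 = 0" by simp
  then show ?thesis
    using total_degree_le_iff[of h 0] by (auto simp: h coeff_pCons coeff_eq_0 split: nat.splits)
qed

text \<open>
  Used with \<open>p = v (c\<^sup>2 + q) / c\<close> and \<open>d = c\<^sup>2 - 1\<close> for a coordinate \<open>v\<close>: subtracting \<open>v g = v (1 + q)\<close>
  from \<open>c p\<close> eliminates \<open>q\<close>.
\<close>

lemma common_divisor_dvd:
  assumes "h dvd g" "h dvd p" and combination: "p * Const c = Const d * v + v * g" and "d \<noteq> 0"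
  shows "h dvd v"
proof -
  have "Const d * v = p * Const c - v * g" by (simp add: combination)
  then have "h dvd Const d * v" using assms(1,2) by (simp add: dvd_diff)
  then have "h dvd Const (1 / d) * (Const d * v)" by (rule dvd_mult)
  also have "Const (1 / d) * (Const d * v) = v"
    using \<open>d \<noteq> 0\<close> by (simp add: Const_def flip: one_pCons)
  finally show ?thesis .
qed

section \<open>From the matrix inequality to a sphere map\<close>

text \<open>
  \<open>odd1\<close> consists of the real cubic polynomials \<open>a z\<^sub>1 + c z\<^sub>1\<^sup>3 + d z\<^sub>1 z\<^sub>2\<^sup>2\<close>, odd in \<open>z\<^sub>1\<close> and
  even in \<open>z\<^sub>2\<close>; \<open>odd2\<close> exchanges the variables.
\<close>

definition odd1 :: "real \<Rightarrow> real \<Rightarrow> real \<Rightarrow> complex poly poly" where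
  "odd1 a c d = [:0, [:of_real a, 0, of_real d:], 0, [:of_real c:]:]"

definition odd2 :: "real \<Rightarrow> real \<Rightarrow> real \<Rightarrow> complex poly poly" where
  "odd2 a c d = [:[:0, of_real a, 0, of_real c:], 0, [:0, of_real d:]:]"

lemma eval2_odd:
  "eval2 (odd1 a c d) z = z$1 * (of_real a + of_real c * (z$1)\<^sup>2 + of_real d * (z$2)\<^sup>2)"
  "eval2 (odd2 a c d) z = z$2 * (of_real a + of_real c * (z$2)\<^sup>2 + of_real d * (z$1)\<^sup>2)"
  by (simp_all add: odd1_def odd2_def eval2_def power2_eq_square algebra_simps)

lemma total_degree_odd:
  "total_degree (odd1 a c d) \<le> 3" "total_degree (odd2 a c d) \<le> 3"
  unfolding total_degree_le_iff odd1_def odd2_def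
  by (auto simp: coeff_pCons split: nat.splits)

lemma total_degree_odd1_eq_3:
  assumes "(c, d) \<noteq> (0, 0)"
  shows "total_degree (odd1 a c d) = 3"
  using assms total_degree_odd(1)[of a c d] le_total_degree[of "odd1 a c d" 3 0]
    le_total_degree[of "odd1 a c d" 1 2]
  by (auto simp: odd1_def coeff_pCons numeral_2_eq_2 numeral_3_eq_3)

lemma binary_form_sum_of_squares:
  fixes a b c :: real
  assumes psd: "\<And>u v. 0 \<le> a * u\<^sup>2 + 2 * b * u * v + c * v\<^sup>2"
  obtains d e f where "a = d\<^sup>2" "b = d * e" "c = e\<^sup>2 + f\<^sup>2"
proof -
  have a: "a \<ge> 0" and c: "c \<ge> 0" using psd[of 1 0] psd[of 0 1] by auto
  show ?thesis
  proof (cases "a = 0")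
    case True
    have "b = 0"
    proof (rule ccontr)
      assume "b \<noteq> 0"
      \<comment> \<open>the form takes the value \<open>-1\<close> there\<close>
      then show False using psd[of "- (c + 1) / (2 * b)" 1] True by (simp add: field_simps)
    qed
    then show ?thesis using that[of 0 0 "sqrt c"] True c by simp
  next
    case False
    with a have a: "a > 0" by simp
    \<comment> \<open>the minimum over \<open>u\<close> for \<open>v = a\<close>\<close>
    have "0 \<le> a * (c - b\<^sup>2 / a)"
      using psd[of "- b" a] a by (simp add: power2_eq_square algebra_simps zero_le_mult_iff)
    then have "0 \<le> c - b\<^sup>2 / a" using a by (simp add: zero_le_mult_iff)
    then show ?thesis
      using that[of "sqrt a" "b / sqrt a" "sqrt (c - b\<^sup>2 / a)"] a by (simp add: power_divide)
  qed
qed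

lemma Qform_expand:
  assumes "x > 0"
  shows "Qform s1 s2 x y u v = (1 + s1\<^sup>2 - x - s1\<^sup>2 / x) * u\<^sup>2 + 2 * (s1 * s2 * (1 - 1 / x)) * u * v
    + (3 + s2\<^sup>2 - x - 2 * y - s2\<^sup>2 / x) * v\<^sup>2"
  using assms by (simp add: Qform_def field_simps power2_eq_square)

lemma Qform_sum_of_squares:
  assumes "x > 0" "\<And>u v. 0 \<le> Qform s1 s2 x y u v"
  obtains d e f where "1 + s1\<^sup>2 - x - s1\<^sup>2 / x = d\<^sup>2" "s1 * s2 * (1 - 1 / x) = d * e"
    "3 + s2\<^sup>2 - x - 2 * y - s2\<^sup>2 / x = e\<^sup>2 + f\<^sup>2"
  using assms(2) binary_form_sum_of_squares unfolding Qform_expand[OF assms(1)] by metis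

text \<open>
  Adding the squares found for \<open>Qform\<close> to the square of \<open>a + (\<sigma>\<^sub>1 w\<^sub>1 + \<sigma>\<^sub>2 w\<^sub>2) / a\<close>, where
  \<open>a = \<surd>x\<close>, cancels all terms with denominator \<open>x\<close>; here \<open>w\<^sub>1, w\<^sub>2\<close> stand for \<open>z\<^sub>1\<^sup>2, z\<^sub>2\<^sup>2\<close>.
\<close>

lemma block_norms:
  fixes a s1 s2 y d e f :: real and w1 w2 :: complex
  assumes "a > 0" and "1 + s1\<^sup>2 - a\<^sup>2 - s1\<^sup>2 / a\<^sup>2 = d\<^sup>2" "s1 * s2 * (1 - 1 / a\<^sup>2) = d * e"
    "3 + s2\<^sup>2 - a\<^sup>2 - 2 * y - s2\<^sup>2 / a\<^sup>2 = e\<^sup>2 + f\<^sup>2"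
  shows "(cmod (of_real a + of_real (s1 / a) * w1 + of_real (s2 / a) * w2))\<^sup>2
      + (cmod (of_real 0 + of_real d * w1 + of_real e * w2))\<^sup>2
      + (cmod (of_real 0 + of_real 0 * w1 + of_real f * w2))\<^sup>2 =
    a\<^sup>2 + (1 + s1\<^sup>2 - a\<^sup>2) * (cmod w1)\<^sup>2 + (3 + s2\<^sup>2 - a\<^sup>2 - 2 * y) * (cmod w2)\<^sup>2
      + 2 * s1 * s2 * (w1 \<bullet> w2) + 2 * (s1 * Re w1 + s2 * Re w2)"
    (is "?lhs = _")
proof -
  have re: "complex_of_real r \<bullet> w = r * Re w" for r w by (simp add: inner_complex_def)
  have "?lhs = a\<^sup>2 + (s1\<^sup>2 / a\<^sup>2 + d\<^sup>2) * (cmod w1)\<^sup>2 + (s2\<^sup>2 / a\<^sup>2 + (e\<^sup>2 + f\<^sup>2)) * (cmod w2)\<^sup>2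
      + 2 * (s1 * s2 / a\<^sup>2 + d * e) * (w1 \<bullet> w2) + 2 * (s1 * Re w1 + s2 * Re w2)"
    unfolding norm_sq_scaled3 re unfolding power2_norm_eq_inner
    using assms(1) by (simp add: power_divide, simp add: power2_eq_square algebra_simps)
  also have "\<dots> = a\<^sup>2 + (1 + s1\<^sup>2 - a\<^sup>2) * (cmod w1)\<^sup>2 + (3 + s2\<^sup>2 - a\<^sup>2 - 2 * y) * (cmod w2)\<^sup>2
      + 2 * s1 * s2 * (w1 \<bullet> w2) + 2 * (s1 * Re w1 + s2 * Re w2)"
    unfolding assms(2-4)[symmetric] by (simp add: right_diff_distrib, simp add: algebra_simps)
  finally show ?thesis .
qed

lemma M_matrix_imp_sphere_map:
  assumes s: "0 \<le> s1" "s1 < 1" "0 \<le> s2" "s2 < 1" "(s1, s2) \<noteq> (0, 0)"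
    and pos: "x > 0" "y > 0" and psd: "pos_semidef (M_matrix s1 s2 x y)" and nz: "M_matrix s1 s2 x y \<noteq> 0"
  shows "\<exists>P. (\<forall>p\<in>set P. eval2 p 0 = 0) \<and> map_degree P = 3 \<and>
            sphere_map P (g_poly s1 s2) \<and> reduced_quotient P (g_poly s1 s2)"
proof -
  define a where "a = sqrt x"
  define b where "b = sqrt y"
  have ab: "a > 0" "b > 0" "a\<^sup>2 = x" "b\<^sup>2 = y" using pos by (simp_all add: a_def b_def)
  have nonneg: "0 \<le> Qform s1 s2 x y u v" "0 \<le> Qform s2 s1 y x u v" for u v
    using psd pos_semidef_M_matrix_iff[OF pos] by auto
  obtain d e f where Q1: "1 + s1\<^sup>2 - x - s1\<^sup>2 / x = d\<^sup>2" "s1 * s2 * (1 - 1 / x) = d * e"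
    "3 + s2\<^sup>2 - x - 2 * y - s2\<^sup>2 / x = e\<^sup>2 + f\<^sup>2"
    using Qform_sum_of_squares[OF pos(1) nonneg(1)] by blast
  obtain d' e' f' where Q2: "1 + s2\<^sup>2 - y - s2\<^sup>2 / y = d'\<^sup>2" "s2 * s1 * (1 - 1 / y) = d' * e'"
    "3 + s1\<^sup>2 - y - 2 * x - s1\<^sup>2 / y = e'\<^sup>2 + f'\<^sup>2"
    using Qform_sum_of_squares[OF pos(2) nonneg(2)] by blast
  \<comment> \<open>the first entry of each half is \<open>z\<^sub>1 (x + q) / \<surd>x\<close> or \<open>z\<^sub>2 (y + q) / \<surd>y\<close>; the other two are the squares
    that make up one block of \<open>M\<^sub>X\<close>\<close>
  define P where "P = [odd1 a (s1 / a) (s2 / a), odd1 0 d e, odd1 0 0 f,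
    odd2 b (s2 / b) (s1 / b), odd2 0 d' e', odd2 0 0 f']"
  have vanish: "\<forall>p\<in>set P. eval2 p 0 = 0" by (simp add: P_def eval2_odd)
  have "map_degree P = 3"
  proof (rule antisym)
    show "map_degree P \<le> 3" by (simp add: P_def map_degree_le_iff total_degree_odd)
    have "total_degree (odd1 a (s1 / a) (s2 / a)) = 3"
      using s(5) ab by (intro total_degree_odd1_eq_3) auto
    then show "3 \<le> map_degree P" using map_degree_le_iff[of P "map_degree P"] by (simp add: P_def)
  qed
  moreover have "sphere_map P (g_poly s1 s2)"
    unfolding sphere_map_def
  proof (intro conjI ballI)
    fix p assume "p \<in> set P"
    have "g_poly s1 s2 \<noteq> 0" by (simp add: g_poly_explicit)
    then show "rational_holomorphic_on p (g_poly s1 s2) (ball 0 1)"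
      by (intro rational_holomorphic_if_nonzero g_poly_nonzero_on_ball s(1-4))
  next
    fix z :: "complex^2" assume "z \<in> sphere 0 1"
    define w1 w2 where "w1 = (z$1)\<^sup>2" and "w2 = (z$2)\<^sup>2"
    define s t where "s = (cmod (z$1))\<^sup>2" and "t = (cmod (z$2))\<^sup>2"
    have t: "t = 1 - s" using \<open>z \<in> sphere 0 1\<close> unfolding mem_sphere_iff s_def t_def by linarith
    have w: "(cmod w1)\<^sup>2 = s\<^sup>2" "(cmod w2)\<^sup>2 = t\<^sup>2" by (simp_all add: w1_def w2_def s_def t_def norm_power)
    note block1 = block_norms[of a s1 d s2 e y f w1 w2, unfolded ab, OF ab(1) Q1]
    note block2 = block_norms[of b s2 d' s1 e' x f' w2 w1, unfolded ab, OF ab(2) Q2]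
    have "(\<Sum>p\<leftarrow>P. (cmod (eval2 p z))\<^sup>2) =
        s * ((cmod (of_real a + of_real (s1 / a) * w1 + of_real (s2 / a) * w2))\<^sup>2
          + (cmod (of_real 0 + of_real d * w1 + of_real e * w2))\<^sup>2
          + (cmod (of_real 0 + of_real 0 * w1 + of_real f * w2))\<^sup>2)
      + t * ((cmod (of_real b + of_real (s2 / b) * w2 + of_real (s1 / b) * w1))\<^sup>2
          + (cmod (of_real 0 + of_real d' * w2 + of_real e' * w1))\<^sup>2
          + (cmod (of_real 0 + of_real 0 * w2 + of_real f' * w1))\<^sup>2)"
      by (simp only: P_def list.map sum_list.Cons sum_list.Nil eval2_odd norm_mult power_mult_distrib
          s_def t_def w1_def w2_def distrib_left[where ?'a = real] add.assoc[where ?'a = real] add_0_right)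
    also have "\<dots> = 1 + s1\<^sup>2 * s\<^sup>2 + s2\<^sup>2 * t\<^sup>2 + 2 * s1 * s2 * (w1 \<bullet> w2) + 2 * (s1 * Re w1 + s2 * Re w2)"
      unfolding block1 block2 w t inner_commute[of w2 w1]
      by (simp add: algebra_simps power2_eq_square)
    also have "\<dots> = (cmod (1 + of_real s1 * w1 + of_real s2 * w2))\<^sup>2"
      unfolding norm_sq_scaled3 w[unfolded power2_norm_eq_inner] by (simp add: inner_complex_def[of 1])
    finally show "(\<Sum>p\<leftarrow>P. (cmod (eval2 p z))\<^sup>2) = (cmod (eval2 (g_poly s1 s2) z))\<^sup>2"
      by (simp add: eval2_g_poly w1_def w2_def)
  qed
  moreover have "reduced_quotient P (g_poly s1 s2)"
    unfolding reduced_quotient_def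
  proof
    assume "\<exists>h. 0 < total_degree h \<and> h dvd g_poly s1 s2 \<and> (\<forall>p\<in>set P. h dvd p)"
    then obtain h where h: "0 < total_degree h" "h dvd g_poly s1 s2"
      "h dvd odd1 a (s1 / a) (s2 / a)" "h dvd odd2 b (s2 / b) (s1 / b)" by (auto simp: P_def)
    have "eval2 h 0 \<noteq> 0"
    proof
      assume "eval2 h 0 = 0"
      then have "eval2 (g_poly s1 s2) 0 = 0" using h(2) by (auto elim!: dvdE)
      then show False by (simp add: eval2_g_poly)
    qed
    then have "\<not> h dvd Z1" "\<not> h dvd Z2"
      using h(1) dvd_Z1_total_degree_0 dvd_Z2_total_degree_0 by auto
    have "odd1 a (s1 / a) (s2 / a) * Const (of_real a) = Const (of_real (x - 1)) * Z1 + Z1 * g_poly s1 s2"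
      "odd2 b (s2 / b) (s1 / b) * Const (of_real b) = Const (of_real (y - 1)) * Z2 + Z2 * g_poly s1 s2"
      using ab(1,2) unfolding ab(3,4)[symmetric]
      by (simp_all add: odd1_def odd2_def Const_def Z1_def Z2_def g_poly_explicit power2_eq_square)
    then have "x = 1" "y = 1"
      using common_divisor_dvd[OF h(2,3)] common_divisor_dvd[OF h(2,4)]
        \<open>\<not> h dvd Z1\<close> \<open>\<not> h dvd Z2\<close>
      by (metis eq_iff_diff_eq_0 of_real_eq_0_iff)+
    with nz s pos show False using M_matrix_eq_0_iff by blast
  qed
  ultimately show ?thesis using vanish by blast
qed

theorem theorem2p4:
  fixes \<sigma>1 \<sigma>2 :: real
  assumes "0 \<le> \<sigma>1" "\<sigma>1 < 1" "0 \<le> \<sigma>2" "\<sigma>2 < 1"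
    and "(\<sigma>1, \<sigma>2) \<noteq> (0, 0)"
  shows "(\<exists>P :: complex poly poly list.
            (\<forall>p\<in>set P. eval2 p 0 = 0) \<and> map_degree P = 3 \<and>
            sphere_map P (g_poly \<sigma>1 \<sigma>2) \<and> reduced_quotient P (g_poly \<sigma>1 \<sigma>2)) \<longleftrightarrow>
         (\<exists>x y :: real. x > 0 \<and> y > 0 \<and>
            pos_semidef (M_matrix \<sigma>1 \<sigma>2 x y) \<and> M_matrix \<sigma>1 \<sigma>2 x y \<noteq> 0)"
  using sphere_map_imp_M_matrix[OF assms] M_matrix_imp_sphere_map[OF assms]
  by (metis order_refl)

end
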